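(* Let $0\le r\le n-1$ and let $P(x_1,\dots,x_n)=\sum_{S\subseteq\{1,\dots,n\},\ |S|\le r}\prod_{i\in S}x_i$ be the independent-set generating polynomial of the uniform matroid $U_{r,n}$. If $\operatorname{Re}x_i<-1/2$ for all $i$, then $P(x)\neq0$. *)

theory Defs
  imports Complex_Main
begin

definition uniform_matroid_indep :: "nat \<Rightarrow> nat \<Rightarrow> nat set set" where
  "uniform_matroid_indep r n = {S. S \<subseteq> {1..n} \<and> card S \<le> r}"

text \<open>The independent-set generating polynomial, as a function of the point \<open>x\<close>.
  It depends only on the coordinates of \<open>x\<close> indexed by the ground set.\<close>

definition indep_gen_poly :: "nat set set \<Rightarrow> (nat \<Rightarrow> complex) \<Rightarrow> complex" where
  "indep_gen_poly \<I> x = (\<Sum>S\<in>\<I>. \<Prod>i\<in>S. x i)"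

end

theory Submission
  imports Defs "HOL-Computational_Algebra.Fundamental_Theorem_Algebra"
begin

text \<open>
  The value at \<open>x\<close> is obtained from the univariate polynomial \<open>\<Sum>k\<le>r. (n choose k) z ^ k\<close> by
  successive polar derivatives with respect to the points \<open>x i\<close>. By Laguerre's theorem, a polar
  derivative at a point of a half-plane preserves the absence of zeros in this half-plane, so only
  the univariate polynomial matters (this is the Grace--Walsh--Szego theorem). With
  \<open>w = (1 + z) / z\<close> and \<open>m = n - r - 1\<close>, it equals \<open>z ^ r * (\<Sum>j\<le>r. (m + j choose j) w ^ (r - j))\<close>,
  and the half-plane \<open>Re z < -1/2\<close> becomes the disc \<open>norm w < 1\<close>. The coefficients of the
  powers of \<open>w\<close> are positive and decreasing, so the Enestrom--Kakeya theorem concludes.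
\<close>

section \<open>Polar derivatives\<close>

text \<open>Inversion carries the half-plane to the disc with diameter from -1/a to 0. Unlike the
  half-plane condition on \<open>v\<close>, the disc condition can be added up over several
  reciprocals.\<close>

lemma inverse_in_disc_iff:
  fixes v :: complex
  assumes "v \<noteq> 0" "a > 0"
  shows "norm (inverse v + of_real (1 / (2 * a))) \<le> 1 / (2 * a) \<longleftrightarrow> Re v \<le> - a"
proof -
  have "inverse v + of_real (1 / (2 * a)) = (of_real (2 * a) + v) / (of_real (2 * a) * v)"
    using assms by (simp add: field_simps)
  then have "norm (inverse v + of_real (1 / (2 * a))) = norm (of_real (2 * a) + v) / (2 * a * norm v)"
    using assms by (simp add: norm_divide norm_mult)
  then have "norm (inverse v + of_real (1 / (2 * a))) \<le> 1 / (2 * a) \<longleftrightarrow>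
      norm (of_real (2 * a) + v) \<le> norm v"
    using assms by (simp only:) (simp add: divide_le_eq)
  also have "\<dots> \<longleftrightarrow> (norm (of_real (2 * a) + v))\<^sup>2 \<le> (norm v)\<^sup>2"
    by (simp add: power_mono_iff)
  also have "\<dots> \<longleftrightarrow> 4 * a * (a + Re v) \<le> 0"
    unfolding cmod_power2 by (simp add: power2_eq_square algebra_simps)
  also have "\<dots> \<longleftrightarrow> Re v \<le> - a"
    using assms by (simp add: mult_le_0_iff; linarith)
  finally show ?thesis .
qed

text \<open>p'/p is the sum of 1/(z - s) over the roots s, and each \<open>z - s\<close> has real
  part at most \<open>- (c - Re z)\<close>. So every summand lies in the disc of
  \<open>inverse_in_disc_iff\<close>; centres and radii add. The induction splits off one root at a
  time.\<close>

lemma logarithmic_derivative_in_disc: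
  fixes p :: "complex poly"
  assumes "\<And>u. Re u < c \<Longrightarrow> poly p u \<noteq> 0" "Re z < c"
  shows "norm (poly (pderiv p) z / poly p z + of_real (degree p / (2 * (c - Re z))))
    \<le> degree p / (2 * (c - Re z))"
  using assms(1)
proof (induction "degree p" arbitrary: p)
  case 0
  then obtain b where "p = [:b:]"
    by (metis degree_eq_zeroE)
  then show ?case
    by simp
next
  case (Suc d)
  let ?a = "c - Re z"
  have "\<not> constant (poly p)"
    using Suc.hyps(2) by (simp add: constant_degree)
  then obtain s where s: "poly p s = 0"
    using fundamental_theorem_of_algebra by blast
  then obtain q where p: "p = [:- s, 1:] * q"
    by (metis dvdE poly_eq_0_iff_dvd)
  have "Re s \<ge> c"
    using s Suc.prems by force
  have q_nz: "poly q u \<noteq> 0" if "Re u < c" for u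
    using Suc.prems[OF that] p by auto
  have "q \<noteq> 0"
    using q_nz[OF assms(2)] by auto
  then have deg: "degree p = Suc (degree q)"
    unfolding p by (subst degree_mult_eq) auto
  have IH: "norm (poly (pderiv q) z / poly q z + of_real (d / (2 * ?a))) \<le> d / (2 * ?a)"
    using Suc.hyps(1)[of q] q_nz deg Suc.hyps(2) by simp
  have zs: "z - s \<noteq> 0"
    using \<open>Re s \<ge> c\<close> assms(2) by auto
  have u: "norm (inverse (z - s) + of_real (1 / (2 * ?a))) \<le> 1 / (2 * ?a)"
    using \<open>Re s \<ge> c\<close> assms(2) zs by (subst inverse_in_disc_iff) auto
  have "poly (pderiv p) z / poly p z = poly (pderiv q) z / poly q z + inverse (z - s)"
    using zs q_nz[OF assms(2)] unfolding p pderiv_mult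
    by (simp add: pderiv_pCons field_simps)
  then have "poly (pderiv p) z / poly p z + of_real (degree p / (2 * ?a)) =
      (poly (pderiv q) z / poly q z + of_real (d / (2 * ?a))) +
      (inverse (z - s) + of_real (1 / (2 * ?a)))"
    by (simp add: Suc.hyps(2)[symmetric] add_divide_distrib)
  then have "norm (poly (pderiv p) z / poly p z + of_real (degree p / (2 * ?a)))
      \<le> d / (2 * ?a) + 1 / (2 * ?a)"
    using norm_triangle_mono[OF IH u] by simp
  then show ?case
    by (simp add: Suc.hyps(2)[symmetric] add_divide_distrib)
qed

text \<open>A zero would force p'/p = n/(z - \<zeta>). The disc bound on p'/p then holds for 1/(z -
  \<zeta>), and inverting back gives Re \<zeta> \<ge> c.\<close>

theorem Laguerre_half_plane:
  fixes p :: "complex poly"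
  assumes nz: "\<And>u. Re u < c \<Longrightarrow> poly p u \<noteq> 0" and "degree p \<le> n" "n > 0"
    and z: "Re z < c" and \<zeta>: "Re \<zeta> < c"
  shows "of_nat n * poly p z + (\<zeta> - z) * poly (pderiv p) z \<noteq> 0"
proof
  assume eq: "of_nat n * poly p z + (\<zeta> - z) * poly (pderiv p) z = 0"
  define a where "a = c - Re z"
  have "a > 0"
    using z by (simp add: a_def)
  define L where "L = poly (pderiv p) z / poly p z"
  have "z \<noteq> \<zeta>"
    using eq nz[OF z] \<open>n > 0\<close> by auto
  then have L: "L = of_nat n * inverse (z - \<zeta>)"
    using eq nz[OF z] unfolding L_def by (simp add: field_simps)
  have "norm (L + of_real (degree p / (2 * a))) \<le> degree p / (2 * a)"
    using logarithmic_derivative_in_disc[OF nz z] by (simp add: L_def a_def)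
  \<comment> \<open>The missing \<open>n - degree p\<close> roots count as roots at infinity: each
    contributes 0, a boundary point of the disc.\<close>
  moreover have "norm (of_real ((n - degree p) / (2 * a)) :: complex) \<le> (n - degree p) / (2 * a)"
    using \<open>a > 0\<close> \<open>degree p \<le> n\<close> by (subst norm_of_real) simp
  ultimately have "norm ((L + of_real (degree p / (2 * a))) + of_real ((n - degree p) / (2 * a)))
      \<le> degree p / (2 * a) + (n - degree p) / (2 * a)"
    by (rule norm_triangle_mono)
  moreover have "degree p / (2 * a) + (n - degree p) / (2 * a) = n / (2 * a)"
    using \<open>degree p \<le> n\<close> by (simp add: add_divide_distrib[symmetric])
  ultimately have "norm (L + of_real (n / (2 * a))) \<le> n / (2 * a)"
    by (metis add.assoc of_real_add)
  moreover have "L + of_real (n / (2 * a)) =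
      of_nat n * (inverse (z - \<zeta>) + of_real (1 / (2 * a)))"
    by (simp add: L algebra_simps)
  ultimately have "n * norm (inverse (z - \<zeta>) + of_real (1 / (2 * a))) \<le> n * (1 / (2 * a))"
    by (simp add: norm_mult)
  then have "norm (inverse (z - \<zeta>) + of_real (1 / (2 * a))) \<le> 1 / (2 * a)"
    using \<open>n > 0\<close> by (subst (asm) mult_le_cancel_left_pos) auto
  then have "Re (z - \<zeta>) \<le> - a"
    using inverse_in_disc_iff[of "z - \<zeta>" a] \<open>z \<noteq> \<zeta>\<close> \<open>a > 0\<close> by simp
  then show False
    using \<zeta> by (simp add: a_def)
qed

text \<open>With the binomial factors split off, the polar derivative acts on coefficients by
  \<open>a k\<close> \<mapsto> \<open>a k + \<zeta> * a (Suc k)\<close>, which is also the effect of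
  setting one variable of a symmetric multiaffine polynomial to \<zeta>.\<close>

lemma polar_derivative_binomial_sum:
  fixes a :: "nat \<Rightarrow> complex" and m :: nat
  defines "p \<equiv> \<Sum>k\<le>Suc m. monom (of_nat (Suc m choose k) * a k) k"
  shows "of_nat (Suc m) * poly p z + (\<zeta> - z) * poly (pderiv p) z =
    of_nat (Suc m) * (\<Sum>k\<le>m. of_nat (m choose k) * (a k + \<zeta> * a (Suc k)) * z ^ k)"
proof -
  have p: "poly p z = (\<Sum>k\<le>Suc m. of_nat (Suc m choose k) * a k * z ^ k)"
    by (simp add: p_def poly_sum poly_monom)
  have p': "poly (pderiv p) z =
      (\<Sum>k\<le>Suc m. of_nat k * of_nat (Suc m choose k) * a k * z ^ (k - 1))"
    unfolding p_def higher_pderiv_sum[of 1, simplified] poly_sum pderiv_monom poly_monom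
    by (simp add: mult.assoc)
  have "of_nat (Suc k) * of_nat (Suc m choose Suc k) =
      (of_nat (Suc m) * of_nat (m choose k) :: complex)" for k
    by (metis Suc_times_binomial of_nat_mult)
  then have 1: "poly (pderiv p) z = of_nat (Suc m) * (\<Sum>k\<le>m. of_nat (m choose k) * a (Suc k) * z ^ k)"
    unfolding p' sum.atMost_Suc_shift sum_distrib_left
    by (simp add: mult.assoc del: of_nat_Suc binomial_Suc_Suc)
  have z: "z * poly (pderiv p) z =
      (\<Sum>k\<le>Suc m. of_nat k * of_nat (Suc m choose k) * a k * z ^ k)"
    unfolding p' sum_distrib_left
  proof (rule sum.cong)
    fix k
    show "z * (of_nat k * of_nat (Suc m choose k) * a k * z ^ (k - 1)) =
        of_nat k * of_nat (Suc m choose k) * a k * z ^ k"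
      \<comment> \<open>At \<open>k = 0\<close> the exponent \<open>k - 1\<close> is truncated, but
        the factor \<open>of_nat k\<close> vanishes.\<close>
      by (cases k) (simp_all add: mult_ac)
  qed simp
  have absorb: "(of_nat (Suc m) - of_nat k) * of_nat (Suc m choose k) =
      (of_nat (Suc m) * of_nat (m choose k) :: complex)" if "k \<le> Suc m" for k
    using binomial_absorb_comp[of "Suc m" k] that
    by (metis diff_Suc_1 of_nat_diff of_nat_mult)
  have "of_nat (Suc m) * poly p z - z * poly (pderiv p) z =
      (\<Sum>k\<le>Suc m. ((of_nat (Suc m) - of_nat k) * of_nat (Suc m choose k)) * a k * z ^ k)"
    unfolding z unfolding p sum_distrib_left sum_subtractf[symmetric]
    by (rule sum.cong) (simp_all add: algebra_simps del: of_nat_Suc binomial_Suc_Suc)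
  also have "\<dots> = (\<Sum>k\<le>Suc m. of_nat (Suc m) * of_nat (m choose k) * a k * z ^ k)"
    by (rule sum.cong) (auto simp only: absorb atMost_iff)
  \<comment> \<open>The top term drops out because \<open>m choose Suc m\<close> is 0.\<close>
  also have "\<dots> = of_nat (Suc m) * (\<Sum>k\<le>m. of_nat (m choose k) * a k * z ^ k)"
    by (simp add: sum_distrib_left mult.assoc del: of_nat_Suc)
  finally have 2: "of_nat (Suc m) * poly p z - z * poly (pderiv p) z =
      of_nat (Suc m) * (\<Sum>k\<le>m. of_nat (m choose k) * a k * z ^ k)" .
  have "of_nat (Suc m) * poly p z + (\<zeta> - z) * poly (pderiv p) z =
      (of_nat (Suc m) * poly p z - z * poly (pderiv p) z) + \<zeta> * poly (pderiv p) z"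
    by (simp add: algebra_simps)
  also have "\<dots> = of_nat (Suc m) *
      ((\<Sum>k\<le>m. of_nat (m choose k) * a k * z ^ k) + (\<Sum>k\<le>m. \<zeta> * (of_nat (m choose k) * a (Suc k) * z ^ k)))"
    unfolding 2 unfolding 1 by (simp add: distrib_left sum_distrib_left[symmetric] mult_ac del: of_nat_Suc)
  also have "\<dots> = of_nat (Suc m) * (\<Sum>k\<le>m. of_nat (m choose k) * (a k + \<zeta> * a (Suc k)) * z ^ k)"
    unfolding sum.distrib[symmetric] by (simp add: algebra_simps del: of_nat_Suc)
  finally show ?thesis .
qed

section \<open>Symmetric multiaffine polynomials\<close>

lemma sum_Pow_insert:
  fixes f :: "'a set \<Rightarrow> 'b::comm_monoid_add"
  assumes "finite A" "v \<notin> A"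
  shows "sum f (Pow (insert v A)) = (\<Sum>S\<in>Pow A. f S + f (insert v S))"
proof -
  have inj: "inj_on (insert v) (Pow A)"
    using assms by (auto simp: inj_on_def)
  have "sum f (Pow (insert v A)) = sum f (Pow A) + sum f (insert v ` Pow A)"
    unfolding Pow_insert using assms by (intro sum.union_disjoint) auto
  then show ?thesis
    by (simp add: sum.reindex[OF inj] sum.distrib)
qed

text \<open>Induction on the variables, for all \<open>a\<close> at once: pairing \<open>S\<close>
  with \<open>insert v S\<close> absorbs \<open>x v\<close> into new coefficients, those of the
  polar derivative at \<open>x v\<close>, so Laguerre's theorem passes the univariate hypothesis
  on.\<close>

theorem Grace_Walsh_Szego_half_plane:
  fixes a :: "nat \<Rightarrow> complex"
  assumes "finite A"
    and "\<And>z. Re z < c \<Longrightarrow> (\<Sum>k\<le>card A. of_nat (card A choose k) * a k * z ^ k) \<noteq> 0"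
    and "\<And>i. i \<in> A \<Longrightarrow> Re (x i) < c"
  shows "(\<Sum>S\<in>Pow A. a (card S) * (\<Prod>i\<in>S. x i)) \<noteq> 0"
  using assms
proof (induction A arbitrary: a rule: finite_induct)
  case empty
  show ?case
    using empty(1)[of "of_real (c - 1)"] by simp
next
  case (insert v A)
  let ?m = "card A"
  define p where "p = (\<Sum>k\<le>Suc ?m. monom (of_nat (Suc ?m choose k) * a k) k)"
  have p: "poly p z = (\<Sum>k\<le>Suc ?m. of_nat (Suc ?m choose k) * a k * z ^ k)" for z
    by (simp add: p_def poly_sum poly_monom)
  have "degree p \<le> Suc ?m"
    unfolding p_def by (rule degree_sum_le) (auto intro: order.trans[OF degree_monom_le])
  moreover have "poly p z \<noteq> 0" if "Re z < c" for z
    using insert.prems(1)[OF that] insert.hyps unfolding p by simp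
  ultimately have "(\<Sum>k\<le>?m. of_nat (?m choose k) * (a k + x v * a (Suc k)) * z ^ k) \<noteq> 0"
    if "Re z < c" for z
    using Laguerre_half_plane[of c p "Suc ?m" z "x v"] that insert.prems(2)[of v]
      polar_derivative_binomial_sum[of ?m a z "x v"]
    unfolding p_def by fastforce
  then have IH: "(\<Sum>S\<in>Pow A. (a (card S) + x v * a (Suc (card S))) * (\<Prod>i\<in>S. x i)) \<noteq> 0"
    using insert.prems(2) by (intro insert.IH) auto
  have "a (card S) * (\<Prod>i\<in>S. x i) + a (card (insert v S)) * (\<Prod>i\<in>insert v S. x i) =
      (a (card S) + x v * a (Suc (card S))) * (\<Prod>i\<in>S. x i)" if "S \<in> Pow A" for S
  proof -
    have "finite S" "v \<notin> S"
      using that insert.hyps finite_subset by auto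
    then show ?thesis
      by (simp add: algebra_simps)
  qed
  then show ?case
    using IH sum_Pow_insert[OF insert.hyps, of "\<lambda>S. a (card S) * (\<Prod>i\<in>S. x i)"] by simp
qed

section \<open>Truncated binomial sums\<close>

theorem Enestrom_Kakeya:
  fixes b :: "nat \<Rightarrow> real" and w :: complex
  assumes dec: "\<And>i. i < r \<Longrightarrow> b (Suc i) \<le> b i" and pos: "b r > 0" and w: "norm w < 1"
  shows "(\<Sum>i\<le>r. of_real (b i) * w ^ i) \<noteq> 0"
proof
  assume 0: "(\<Sum>i\<le>r. of_real (b i) * w ^ i) = 0"
  \<comment> \<open>By telescoping, the expression inside the norm is the sum of
    \<open>(b (Suc i) - b i) * w ^ Suc i\<close> over \<open>i < k\<close>; each power of
    \<open>w\<close> has norm at most \<open>norm w\<close>.\<close>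
  have "norm ((1 - w) * (\<Sum>i\<le>k. of_real (b i) * w ^ i) - of_real (b 0) + of_real (b k) * w ^ Suc k)
      \<le> (b 0 - b k) * norm w" if "k \<le> r" for k
    using that
  proof (induction k)
    case 0
    show ?case
      by (simp add: algebra_simps)
  next
    case (Suc k)
    have "norm w ^ Suc k \<le> norm w"
      using w power_decreasing[of 1 "Suc k" "norm w"] by simp
    then have "norm (of_real (b (Suc k) - b k) * w ^ Suc k) \<le> (b k - b (Suc k)) * norm w"
      using dec[of k] Suc.prems unfolding norm_mult norm_of_real norm_power
      by (intro mult_mono) auto
    from norm_triangle_mono[OF Suc.IH this] Suc.prems show ?case
      by (simp add: algebra_simps)
  qed
  from this[of r] have "norm (of_real (b r) * w ^ Suc r - of_real (b 0)) \<le> (b 0 - b r) * norm w"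
    unfolding 0 by simp
  moreover have "norm w ^ Suc r \<le> norm w"
    using w power_decreasing[of 1 "Suc r" "norm w"] by simp
  then have "norm (of_real (b r) * w ^ Suc r) \<le> b r * norm w"
    using pos unfolding norm_mult norm_of_real norm_power by simp
  ultimately have "norm (of_real (b 0) :: complex) \<le> b 0 * norm w"
    using norm_triangle_sub[of "of_real (b 0) :: complex" "of_real (b r) * w ^ Suc r"]
    by (simp add: norm_minus_commute algebra_simps)
  \<comment> \<open>Hence \<open>b 0 > 0\<close>, which contradicts
    \<open>b 0 \<le> b 0 * norm w\<close>.\<close>
  moreover have "b r \<le> b 0"
    using inc_induct[of 0 r "\<lambda>i. b r \<le> b i"] dec order_trans by fastforce
  ultimately show False
    using pos w by (simp add: mult_le_cancel_left1)
qed

text \<open>Pascal's rule; the subtracted monomial is what multiplication by \<open>1 + z\<close>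
  pushes past the truncation.\<close>

lemma truncated_binomial_Suc:
  fixes z :: "'a::comm_ring_1"
  shows "(\<Sum>k\<le>r. of_nat (Suc n choose k) * z ^ k) =
    (1 + z) * (\<Sum>k\<le>r. of_nat (n choose k) * z ^ k) - of_nat (n choose r) * z ^ Suc r"
  by (induction r) (simp_all add: algebra_simps)

text \<open>Both sides, divided by \<open>(1 + z) ^ n\<close> with \<open>n = m + r + 1\<close>, are the probability of at most
  \<open>r\<close> successes in \<open>n\<close> independent trials with success odds \<open>z\<close>; on the right, \<open>j\<close> is the number
  of successes before the failure number \<open>m + 1\<close>.\<close>

lemma truncated_binomial_eq_negative_binomial:
  fixes z :: "'a::comm_ring_1"
  shows "(\<Sum>k\<le>r. of_nat (m + r + 1 choose k) * z ^ k) =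
    (\<Sum>j\<le>r. of_nat (m + j choose j) * z ^ j * (1 + z) ^ (r - j))"
proof (induction r)
  case 0
  show ?case
    by simp
next
  case (Suc r)
  have "(\<Sum>j\<le>r. of_nat (m + j choose j) * z ^ j * (1 + z) ^ (Suc r - j)) =
      (1 + z) * (\<Sum>j\<le>r. of_nat (m + j choose j) * z ^ j * (1 + z) ^ (r - j))"
    unfolding sum_distrib_left
    by (rule sum.cong) (simp_all add: Suc_diff_le mult_ac)
  \<comment> \<open>The term \<open>k = Suc r\<close> of the old row, times \<open>1 + z\<close>,
    loses its higher monomial to the overflow; what remains is the new summand
    \<open>j = Suc r\<close>.\<close>
  then show ?case
    using truncated_binomial_Suc[of "m + r + 1" z "Suc r"] Suc.IH
    by (simp add: algebra_simps del: binomial_Suc_Suc)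
qed

lemma truncated_binomial_nonzero:
  assumes "r < n" and z: "Re z < - 1 / 2"
  shows "(\<Sum>k\<le>r. of_nat (n choose k) * z ^ k) \<noteq> 0"
proof -
  define m where "m = n - r - 1"
  have n: "n = m + r + 1"
    using \<open>r < n\<close> by (simp add: m_def)
  have "z \<noteq> 0"
    using z by auto
  define w where "w = (1 + z) / z"
  \<comment> \<open>The index is reversed: after factoring out \<open>z ^ r\<close>, the power
    \<open>w ^ i\<close> belongs to \<open>j = r - i\<close>.\<close>
  define b where "b i = real (m + (r - i) choose (r - i))" for i
  \<comment> \<open>Left of the line Re z = -1/2, points are closer to -1 than to 0.\<close>
  have "(norm (1 + z))\<^sup>2 < (norm z)\<^sup>2"
    using z unfolding cmod_power2 by (simp add: power2_eq_square algebra_simps)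
  then have "norm (1 + z) < norm z"
    by (rule power_less_imp_less_base) simp
  then have w: "norm w < 1"
    using \<open>z \<noteq> 0\<close> by (simp add: w_def norm_divide)
  have dec: "b (Suc i) \<le> b i" if "i < r" for i
  proof -
    have "r - i = Suc (r - Suc i)"
      using that by simp
    then show ?thesis
      by (simp add: b_def)
  qed
  have "(\<Sum>k\<le>r. of_nat (n choose k) * z ^ k) =
      (\<Sum>j\<le>r. of_nat (m + j choose j) * z ^ j * (1 + z) ^ (r - j))"
    unfolding n by (rule truncated_binomial_eq_negative_binomial)
  also have "\<dots> = (\<Sum>i\<le>r. of_nat (m + (r - i) choose (r - i)) * z ^ (r - i) * (1 + z) ^ i)"
    by (rule sum.reindex_bij_witness[of _ "\<lambda>i. r - i" "\<lambda>i. r - i"]) auto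
  also have "\<dots> = z ^ r * (\<Sum>i\<le>r. of_real (b i) * w ^ i)"
    unfolding sum_distrib_left
    by (rule sum.cong) (use \<open>z \<noteq> 0\<close> in \<open>auto simp: b_def w_def power_divide power_diff\<close>)
  finally show ?thesis
    using Enestrom_Kakeya[of r b w] dec w \<open>z \<noteq> 0\<close> by (simp add: b_def)
qed

theorem theorem9p2:
  fixes r n :: nat and x :: "nat \<Rightarrow> complex"
  assumes "r < n"
    and "\<And>i. i \<in> {1..n} \<Longrightarrow> Re (x i) < - 1 / 2"
  shows "indep_gen_poly (uniform_matroid_indep r n) x \<noteq> 0"
proof -
  \<comment> \<open>The bound on \<open>card S\<close> becomes a coefficient, so that the sum runs
    over all subsets.\<close>
  define a :: "nat \<Rightarrow> complex" where "a k = (if k \<le> r then 1 else 0)" for k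
  have "(\<Sum>k\<le>n. of_nat (n choose k) * a k * z ^ k) = (\<Sum>k\<le>r. of_nat (n choose k) * z ^ k)" for z
    using \<open>r < n\<close> by (intro sum.mono_neutral_cong_right) (auto simp: a_def)
  then have "(\<Sum>S\<in>Pow {1..n}. a (card S) * (\<Prod>i\<in>S. x i)) \<noteq> 0"
    using truncated_binomial_nonzero[OF \<open>r < n\<close>] assms(2)
    by (intro Grace_Walsh_Szego_half_plane[where c = "- 1 / 2"]) auto
  moreover have "indep_gen_poly (uniform_matroid_indep r n) x =
      (\<Sum>S\<in>Pow {1..n}. a (card S) * (\<Prod>i\<in>S. x i))"
    unfolding indep_gen_poly_def uniform_matroid_indep_def
    by (intro sum.mono_neutral_cong_left) (auto simp: a_def)
  ultimately show ?thesis
    by simp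
qed

end
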